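(* There exists an instance (with a credible agent) where an optimal $\mathsf{SES}$ mechanism yields a strictly higher expected payoff for the principal than any $\mathsf{ES}$ mechanism does.
   Context: An instance consists of finite sets $\Theta$ (states), $A$ (actions), $T$ (agent types), a prior $\mu\in\Delta(\Theta)$, a type distribution $\rho\in\Delta(T)$, a principal payoff function $v(\theta,a)$ and agent payoff functions $u_t(\theta,a)$, $t\in T$. The state $\theta\sim\mu$ is observed only by the principal; the agent's type $t\sim\rho$, independent of $\theta$, is known only to the agent. The principal commits to a mechanism. $\mathsf{ES}$ mechanism (elicitation, then signaling): the agent reports a type $t'\in T$; the principal sends a signal $g\sim\pi_{t'}(\cdot\mid\theta)$, where $\pi_{t'}:\Theta\to\Delta(G)$ for a finite set $G$; then the agent plays an action $a$. $\mathsf{SES}$ mechanism (with pre-signaling): the principal first sends a pre-signal $g'\sim\pi(\cdot\mid\theta)$, $\pi:\Theta\to\Delta(G')$; the agent, having observed $g'$, reports a type $t'$; the principal sends $g\sim\pi_{g',t'}(\cdot\mid\theta)$; then the agent plays an action $a$. In both cases the principal gets $v(\theta,a)$ and an agent of true type $t$ gets $u_t(\theta,a)$. The agent is credible: after reporting $t'$ he must play an action maximizing the expectation of $u_{t'}(\theta,\cdot)$ under his posterior belief about $\theta$ given all received signals, even if $t'\neq t$. He chooses his report (given his current posterior and the mechanism) to maximize his expected payoff under his true payoff function $u_t$. Ties are broken as the mechanism decides. *)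

theory Defs
  imports "HOL-Probability.Probability_Mass_Function"
begin

text \<open>Beliefs are updated by Bayes' rule. For a belief \<open>p\<close> on states and a signaling kernel \<open>K\<close>,
  \<open>posterior p K x\<close> is the conditional law of the state given that the signal \<open>x\<close> was observed.
  It is meaningful only for signals of positive probability, \<open>x \<in> set_pmf (bind_pmf p K)\<close>.\<close>

definition posterior :: "'s pmf \<Rightarrow> ('s \<Rightarrow> 'x pmf) \<Rightarrow> 'x \<Rightarrow> 's pmf" where
  "posterior p K x =
     map_pmf fst (cond_pmf (bind_pmf p (\<lambda>s. map_pmf (Pair s) (K s))) {z. snd z = x})"

lemma pmf_joint:
  "pmf (bind_pmf p (\<lambda>s. map_pmf (Pair s) (K s))) (s, x) = pmf p s * pmf (K s) x"
proof -
  have "pmf (map_pmf (Pair s') (K s')) (s, x) = pmf (K s) x * indicator {s} s'" for s'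
  proof (cases "s' = s")
    case True
    then show ?thesis
      by (simp add: pmf_map_inj' inj_on_def)
  next
    case False
    then show ?thesis
      by (auto simp: pmf_eq_0_set_pmf)
  qed
  then have "pmf (bind_pmf p (\<lambda>s. map_pmf (Pair s) (K s))) (s, x) =
      (\<integral>s'. pmf (K s) x * indicator {s} s' \<partial>measure_pmf p)"
    by (simp add: pmf_bind)
  then show ?thesis
    by (simp add: measure_pmf_single)
qed

lemma snd_joint: "map_pmf snd (bind_pmf p (\<lambda>s. map_pmf (Pair s) (K s))) = bind_pmf p K"
  by (simp add: map_bind_pmf pmf.map_comp o_def)

lemma pmf_posterior:
  fixes p :: "'s pmf" and K :: "'s \<Rightarrow> 'x pmf"
  assumes "x \<in> set_pmf (bind_pmf p K)"
  shows "pmf (posterior p K x) s = pmf p s * pmf (K s) x / pmf (bind_pmf p K) x"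
proof -
  let ?J = "bind_pmf p (\<lambda>s. map_pmf (Pair s) (K s))"
  let ?E = "{z. snd z = x} :: ('s \<times> 'x) set"
  have ne: "set_pmf ?J \<inter> ?E \<noteq> {}"
    using assms by force
  have m: "measure ?J ?E = pmf (bind_pmf p K) x"
    by (subst snd_joint[symmetric]) (simp add: pmf_map vimage_def)
  have "pmf (posterior p K x) s = measure (cond_pmf ?J ?E) (fst -` {s})"
    by (simp add: posterior_def pmf_map)
  also have "\<dots> = measure (cond_pmf ?J ?E) {(s, x)}"
    by (rule measure_pmf.finite_measure_eq_AE) (auto simp: AE_measure_pmf_iff set_cond_pmf[OF ne])
  also have "\<dots> = pmf ?J (s, x) / measure ?J ?E"
    by (simp add: pmf_cond[OF ne] measure_pmf_single)
  finally show ?thesis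
    by (simp add: m pmf_joint)
qed

text \<open>Updating first on \<open>x\<close> and then on \<open>y\<close> is the same as updating on the pair \<open>(x, y)\<close>.\<close>

lemma posterior_posterior:
  assumes "x \<in> set_pmf (bind_pmf p K)" "y \<in> set_pmf (bind_pmf (posterior p K x) (L x))"
  shows "posterior (posterior p K x) (L x) y =
         posterior p (\<lambda>s. bind_pmf (K s) (\<lambda>x. map_pmf (Pair x) (L x s))) (x, y)"
proof -
  let ?KL = "\<lambda>s. bind_pmf (K s) (\<lambda>x. map_pmf (Pair x) (L x s))"
  define c where "c = pmf (bind_pmf p K) x"
  have c: "c > 0"
    using assms(1) by (simp add: c_def pmf_positive)
  have y: "pmf (bind_pmf (posterior p K x) (L x)) y > 0"
    using assms(2) by (simp add: pmf_positive)
  obtain s where s: "s \<in> set_pmf (posterior p K x)" "y \<in> set_pmf (L x s)"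
    using assms(2) by auto
  have "pmf p s * pmf (K s) x \<noteq> 0"
    using s(1) pmf_posterior[OF assms(1), of s] by (auto simp: set_pmf_iff)
  then have "s \<in> set_pmf p" "x \<in> set_pmf (K s)"
    by (simp_all add: set_pmf_iff)
  then have xy: "(x, y) \<in> set_pmf (bind_pmf p ?KL)"
    using s(2) by fastforce
  have eq: "pmf (posterior (posterior p K x) (L x) y) s * pmf (bind_pmf (posterior p K x) (L x)) y * c
          = pmf (posterior p ?KL (x, y)) s * pmf (bind_pmf p ?KL) (x, y)" for s
    using c y pmf_positive[OF xy]
    by (simp add: pmf_posterior[OF assms(1)] pmf_posterior[OF assms(2)] pmf_posterior[OF xy]
        pmf_joint c_def)
  have "pmf (bind_pmf (posterior p K x) (L x)) y * c = pmf (bind_pmf p ?KL) (x, y)"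
  proof -
    have "ennreal (pmf (bind_pmf (posterior p K x) (L x)) y * c)
        = (\<integral>\<^sup>+s. ennreal (pmf (L x s) y) \<partial>posterior p K x) * ennreal c"
      using c by (simp add: ennreal_mult ennreal_pmf_bind)
    also have "\<dots> = (\<integral>\<^sup>+s. ennreal (pmf (posterior p K x) s * c) * ennreal (pmf (L x s) y) \<partial>count_space UNIV)"
      using c by (subst nn_integral_measure_pmf, subst nn_integral_multc[symmetric])
        (auto intro!: nn_integral_cong simp: ennreal_mult ac_simps)
    also have "\<dots> = (\<integral>\<^sup>+s. ennreal (pmf p s) * ennreal (pmf (?KL s) (x, y)) \<partial>count_space UNIV)"
      using c by (simp add: pmf_posterior[OF assms(1)] pmf_joint c_def ennreal_mult[symmetric] mult_ac)
    also have "\<dots> = ennreal (pmf (bind_pmf p ?KL) (x, y))"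
      by (simp add: ennreal_pmf_bind nn_integral_measure_pmf)
    finally show ?thesis
      using c by simp
  qed
  then show ?thesis
    using eq pmf_positive[OF xy] by (auto intro!: pmf_eqI simp: mult.assoc)
qed

record ('s, 'a, 't) game =
  states :: "'s set"
  actions :: "'a set"
  agent_types :: "'t set"
  prior :: "'s pmf"
  type_dist :: "'t pmf"
  principal_payoff :: "'s \<Rightarrow> 'a \<Rightarrow> real"
  agent_payoff :: "'t \<Rightarrow> 's \<Rightarrow> 'a \<Rightarrow> real"

definition game :: "('s, 'a, 't) game \<Rightarrow> bool" where
  "game I \<longleftrightarrow> finite (states I) \<and> finite (actions I) \<and> actions I \<noteq> {} \<and> finite (agent_types I) \<and>
     set_pmf (prior I) \<subseteq> states I \<and> set_pmf (type_dist I) \<subseteq> agent_types I"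

definition best_actions :: "('s, 'a, 't) game \<Rightarrow> 't \<Rightarrow> 's pmf \<Rightarrow> 'a set" where
  "best_actions I t q = {a \<in> actions I. \<forall>b \<in> actions I.
     measure_pmf.expectation q (\<lambda>s. agent_payoff I t s b)
       \<le> measure_pmf.expectation q (\<lambda>s. agent_payoff I t s a)}"

text \<open>\<open>signal_law M t s\<close> is the law of the signal in state \<open>s\<close> after report \<open>t\<close>. Since the mechanism
  decides how ties are broken, it also carries the action played after each report and signal
  and the report made by each true type; \<open>es_incentives\<close> below requires both to be optimal.\<close>

record ('s, 'a, 't, 'g) es_mech =
  signals :: "'g set"
  signal_law :: "'t \<Rightarrow> 's \<Rightarrow> 'g pmf"
  chosen_action :: "'t \<Rightarrow> 'g \<Rightarrow> 'a"
  chosen_report :: "'t \<Rightarrow> 't"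

definition es_format :: "('s, 'a, 't) game \<Rightarrow> ('s, 'a, 't, 'g) es_mech \<Rightarrow> bool" where
  "es_format I M \<longleftrightarrow> finite (signals M) \<and>
     (\<forall>t \<in> agent_types I. \<forall>s \<in> states I. set_pmf (signal_law M t s) \<subseteq> signals M)"

definition action_law :: "('s, 'a, 't, 'g) es_mech \<Rightarrow> 't \<Rightarrow> 's \<Rightarrow> 'a pmf" where
  "action_law M t s = map_pmf (chosen_action M t) (signal_law M t s)"

text \<open>Expected payoff of true type \<open>t\<close> from reporting \<open>t'\<close> when his current belief is \<open>p\<close>.\<close>

definition report_payoff ::
  "('s, 'a, 't) game \<Rightarrow> 's pmf \<Rightarrow> ('s, 'a, 't, 'g) es_mech \<Rightarrow> 't \<Rightarrow> 't \<Rightarrow> real" where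
  "report_payoff I p M t t' =
     measure_pmf.expectation (bind_pmf p (\<lambda>s. map_pmf (Pair s) (action_law M t' s)))
       (\<lambda>(s, a). agent_payoff I t s a)"

text \<open>Behavior of the agent when elicitation starts at belief \<open>p\<close>. Credibility is imposed after
  every report, including reports that no type makes.\<close>

definition es_incentives :: "('s, 'a, 't) game \<Rightarrow> 's pmf \<Rightarrow> ('s, 'a, 't, 'g) es_mech \<Rightarrow> bool" where
  "es_incentives I p M \<longleftrightarrow>
     (\<forall>t' \<in> agent_types I. \<forall>g \<in> set_pmf (bind_pmf p (signal_law M t')).
        chosen_action M t' g \<in> best_actions I t' (posterior p (signal_law M t') g)) \<and>
     (\<forall>t \<in> agent_types I. chosen_report M t \<in> agent_types I \<and>
        (\<forall>t' \<in> agent_types I. report_payoff I p M t t' \<le> report_payoff I p M t (chosen_report M t)))"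

definition es_mechanism :: "('s, 'a, 't) game \<Rightarrow> ('s, 'a, 't, 'g) es_mech \<Rightarrow> bool" where
  "es_mechanism I M \<longleftrightarrow> es_format I M \<and> es_incentives I (prior I) M"

definition es_value :: "('s, 'a, 't) game \<Rightarrow> ('s, 'a, 't, 'g) es_mech \<Rightarrow> real" where
  "es_value I M = measure_pmf.expectation
     (do {
        s \<leftarrow> prior I;
        t \<leftarrow> type_dist I;
        a \<leftarrow> action_law M (chosen_report M t) s;
        return_pmf (s, a)
      }) (\<lambda>(s, a). principal_payoff I s a)"

record ('s, 'a, 't, 'h, 'g) ses_mech =
  presignals :: "'h set"
  presignal_law :: "'s \<Rightarrow> 'h pmf"
  continuation :: "'h \<Rightarrow> ('s, 'a, 't, 'g) es_mech"

definition ses_mechanism :: "('s, 'a, 't) game \<Rightarrow> ('s, 'a, 't, 'h, 'g) ses_mech \<Rightarrow> bool" where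
  "ses_mechanism I S \<longleftrightarrow> finite (presignals S) \<and>
     (\<forall>s \<in> states I. set_pmf (presignal_law S s) \<subseteq> presignals S) \<and>
     (\<forall>h \<in> presignals S. es_format I (continuation S h)) \<and>
     (\<forall>h \<in> set_pmf (bind_pmf (prior I) (presignal_law S)).
        es_incentives I (posterior (prior I) (presignal_law S) h) (continuation S h))"

definition ses_value :: "('s, 'a, 't) game \<Rightarrow> ('s, 'a, 't, 'h, 'g) ses_mech \<Rightarrow> real" where
  "ses_value I S = measure_pmf.expectation
     (do {
        s \<leftarrow> prior I;
        h \<leftarrow> presignal_law S s;
        t \<leftarrow> type_dist I;
        a \<leftarrow> action_law (continuation S h) (chosen_report (continuation S h) t) s;
        return_pmf (s, a)
      }) (\<lambda>(s, a). principal_payoff I s a)"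

text \<open>The competing mechanisms use the same label types for signals as \<open>S\<close>; for infinite label
  types this is no restriction, as only finitely many labels are ever used.\<close>

definition optimal_ses :: "('s, 'a, 't) game \<Rightarrow> ('s, 'a, 't, 'h, 'g) ses_mech \<Rightarrow> bool" where
  "optimal_ses I S \<longleftrightarrow> ses_mechanism I S \<and>
     (\<forall>S' :: ('s, 'a, 't, 'h, 'g) ses_mech. ses_mechanism I S' \<longrightarrow> ses_value I S' \<le> ses_value I S)"

end

theory Submission
  imports Defs
begin

text \<open>The principal wants the action to match the state. The four states form two pairs, and type
  \<open>t\<close> is aligned with the principal on pair \<open>t\<close> only: on the other pair a match is worth 2 to him,
  but he would rather play the opposite state, worth 3. A pre-signal announces the pair \<open>h\<close>; the
  report \<open>h\<close> is then answered with full revelation and the other report with nothing. Both types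
  report \<open>h\<close>, because a certain match (2) is better than a guess at the opposite state (3/2), so the
  principal always obtains a match. Without the pre-signal a type makes the same report \<open>r\<close> in all
  states; a mechanism that always induces a match must reveal the state to him, and then credibility
  forces a mismatch on the pair other than \<open>r\<close>. Since matching for sure is an absolute upper bound,
  optimality of the pre-signaling mechanism is immediate.\<close>

text \<open>For a deterministic signal the joint law is the image of \<open>p\<close> under the
  graph map of \<open>f\<close>, so learning \<open>x\<close> is conditioning on a fibre of
  \<open>f\<close>.\<close>

lemma posterior_return_pmf:
  assumes "x \<in> f ` set_pmf p"
  shows "posterior p (\<lambda>s. return_pmf (f s)) x = cond_pmf p (f -` {x})"
proof -
  have "bind_pmf p (\<lambda>s. map_pmf (Pair s) (return_pmf (f s))) = map_pmf (\<lambda>s. (s, f s)) p"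
    by (simp add: map_pmf_def bind_return_pmf)
  moreover have "cond_pmf (map_pmf (\<lambda>s. (s, f s)) p) {z. snd z = x} =
      map_pmf (\<lambda>s. (s, f s)) (cond_pmf p ((\<lambda>s. (s, f s)) -` {z. snd z = x}))"
    using assms by (intro cond_map_pmf) auto
  ultimately show ?thesis
    by (simp add: posterior_def pmf.map_comp o_def vimage_def)
qed

text \<open>By Bayes' rule the posterior weight vanishes exactly when the prior weight or the
  likelihood does. Point-mass beliefs can thus be recognized from supports alone.\<close>

lemma set_posterior:
  assumes "x \<in> set_pmf (bind_pmf p K)"
  shows "set_pmf (posterior p K x) = {s \<in> set_pmf p. x \<in> set_pmf (K s)}"
proof -
  have "pmf (posterior p K x) s \<noteq> 0 \<longleftrightarrow> pmf p s \<noteq> 0 \<and> pmf (K s) x \<noteq> 0" for s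
    using pmf_positive[OF assms] by (simp add: pmf_posterior[OF assms])
  then show ?thesis
    by (simp add: set_pmf_eq)
qed

lemma cond_pmf_of_set:
  assumes "finite A" "A \<inter> B \<noteq> {}"
  shows "cond_pmf (pmf_of_set A) B = pmf_of_set (A \<inter> B)"
proof -
  have A: "A \<noteq> {}"
    using assms(2) by auto
  moreover have "set_pmf (pmf_of_set A) \<inter> B \<noteq> {}"
    using assms A by simp
  moreover have "card A \<noteq> 0"
    using assms(1) A by simp
  ultimately show ?thesis
    using assms by (intro pmf_eqI) (auto simp: pmf_cond measure_pmf_of_set indicator_def)
qed

text \<open>\<open>s div 2\<close> is the pair of \<open>s\<close>; \<open>(s + 2) mod 4\<close> is
  its opposite state, in the other pair.\<close>

definition matching_game :: "(nat, nat, nat) game" where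
  "matching_game = \<lparr>states = {..<4}, actions = {..<4}, agent_types = {..<2},
     prior = pmf_of_set {..<4}, type_dist = pmf_of_set {..<2},
     principal_payoff = (\<lambda>s a. of_bool (a = s)),
     agent_payoff = (\<lambda>t s a. if a = s then 2
       else if s div 2 \<noteq> t \<and> a = (s + 2) mod 4 then 3 else 0)\<rparr>"

text \<open>The constant signal 0 carries no information. After it, the opposites of
  \<open>2 * h\<close> and \<open>2 * h + 1\<close> are equally good guesses; the tie goes to the
  former.\<close>

definition pair_continuation :: "nat \<Rightarrow> (nat, nat, nat, nat) es_mech" where
  "pair_continuation h = \<lparr>signals = {..<4},
     signal_law = (\<lambda>t s. return_pmf (if t = h then s else 0)),
     chosen_action = (\<lambda>t g. if t = h then g else (2 * h + 2) mod 4),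
     chosen_report = (\<lambda>_. h)\<rparr>"

definition pair_mechanism :: "(nat, nat, nat, nat, nat) ses_mech" where
  "pair_mechanism = \<lparr>presignals = {..<2}, presignal_law = (\<lambda>s. return_pmf (s div 2)),
     continuation = pair_continuation\<rparr>"

lemma set_prior_matching_game: "set_pmf (prior matching_game) = {..<4}"
  and set_type_dist_matching_game: "set_pmf (type_dist matching_game) = {..<2}"
  by (simp_all add: matching_game_def lessThan_empty_iff)

lemma game_matching_game: "game matching_game"
  using set_prior_matching_game set_type_dist_matching_game
  by (auto simp: game_def matching_game_def lessThan_empty_iff)

lemma posterior_pair:
  assumes "h < 2"
  shows "posterior (prior matching_game) (presignal_law pair_mechanism) h
       = pmf_of_set {2 * h, 2 * h + 1}"
proof -
  have eq: "{..<4} \<inter> (\<lambda>s. s div 2) -` {h} = {2 * h, 2 * h + 1}"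
    using assms by auto
  have "h \<in> (\<lambda>s. s div 2) ` {..<4::nat}"
    using assms by (intro image_eqI[of _ _ "2 * h"]) auto
  then have "posterior (prior matching_game) (presignal_law pair_mechanism) h
      = cond_pmf (prior matching_game) ((\<lambda>s. s div 2) -` {h})"
    by (simp add: pair_mechanism_def posterior_return_pmf set_prior_matching_game)
  also have "\<dots> = pmf_of_set {2 * h, 2 * h + 1}"
    using cond_pmf_of_set[of "{..<4}" "(\<lambda>s. s div 2) -` {h}"]
    by (simp only: eq) (simp add: matching_game_def)
  finally show ?thesis .
qed

lemma expectation_pmf_of_pair:
  fixes f :: "'a \<Rightarrow> real"
  assumes "x \<noteq> y"
  shows "measure_pmf.expectation (pmf_of_set {x, y}) f = (f x + f y) / 2"
  using assms by (subst integral_pmf_of_set) auto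

lemma es_incentives_pair:
  assumes "h < 2"
  shows "es_incentives matching_game (pmf_of_set {2 * h, 2 * h + 1}) (pair_continuation h)"
proof -
  let ?p = "pmf_of_set {2 * h, 2 * h + 1}"
  let ?M = "pair_continuation h"
  have set_p: "set_pmf ?p = {2 * h, 2 * h + 1}"
    by simp
  have "chosen_action ?M t g \<in> best_actions matching_game t (posterior ?p (signal_law ?M t) g)"
    if t: "t < 2" and g: "g \<in> set_pmf (bind_pmf ?p (signal_law ?M t))" for t g
  proof (cases "t = h")
    case True
    then have g': "g \<in> {2 * h, 2 * h + 1}"
      using g set_p by (simp add: pair_continuation_def bind_return_pmf' del: set_pmf_of_set)
    have "set_pmf (posterior ?p (signal_law ?M t) g) = {g}"
      unfolding set_posterior[OF g] set_p using g' True by (auto simp: pair_continuation_def)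
    then have "posterior ?p (signal_law ?M t) g = return_pmf g"
      by (simp add: set_pmf_subset_singleton[symmetric])
    then show ?thesis
      using True g' assms
      by (auto simp: best_actions_def matching_game_def pair_continuation_def)
  next
    case False
    then have "g = 0"
      using g by (simp add: pair_continuation_def)
    then have "posterior ?p (signal_law ?M t) g = ?p"
      using False set_pmf_not_empty[of ?p]
      by (simp add: pair_continuation_def posterior_return_pmf cond_pmf_of_set)
    \<comment> \<open>At the uniform belief on the pair, either opposite state yields 3/2 and either
      match only 1.\<close>
    moreover have "h = 0 \<and> t = 1 \<or> h = 1 \<and> t = 0"
      using False t assms by auto
    ultimately show ?thesis
      using False
      by (auto simp: best_actions_def matching_game_def pair_continuation_def
          expectation_pmf_of_pair)
  qed
  moreover have "report_payoff matching_game ?p ?M t t' \<le> report_payoff matching_game ?p ?M t h"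
    if "t < 2" "t' < 2" for t t'
  proof -
    \<comment> \<open>Reporting \<open>h\<close> yields 2 to both types; the other report yields 0
      to type \<open>h\<close> and 3/2 to the other type.\<close>
    have payoff: "report_payoff matching_game ?p ?M t t' =
        (agent_payoff matching_game t (2 * h) (if t' = h then 2 * h else (2 * h + 2) mod 4) +
         agent_payoff matching_game t (2 * h + 1) (if t' = h then 2 * h + 1 else (2 * h + 2) mod 4)) / 2"
      for t'
      by (simp add: report_payoff_def action_law_def pair_continuation_def
          map_pmf_def[symmetric] expectation_pmf_of_pair)
    show ?thesis
      unfolding payoff using assms that by (auto simp: matching_game_def less_2_cases_iff)
  qed
  ultimately show ?thesis
    using assms
    by (simp add: es_incentives_def) (simp add: matching_game_def pair_continuation_def)
qed

lemma ses_mechanism_pair: "ses_mechanism matching_game pair_mechanism"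
proof -
  have "set_pmf (bind_pmf (prior matching_game) (presignal_law pair_mechanism)) \<subseteq> {..<2}"
    by (auto simp: set_prior_matching_game pair_mechanism_def)
  moreover have "es_format matching_game (pair_continuation h)" for h
    by (auto simp: es_format_def pair_continuation_def matching_game_def)
  ultimately show ?thesis
    using posterior_pair es_incentives_pair
    by (auto simp: ses_mechanism_def subset_iff pair_mechanism_def)
       (auto simp: matching_game_def)
qed

lemma ses_value_pair: "ses_value matching_game pair_mechanism = 1"
proof -
  have "ses_value matching_game pair_mechanism
      = measure_pmf.expectation (map_pmf (\<lambda>s. (s, s)) (prior matching_game))
          (\<lambda>(s, a). principal_payoff matching_game s a)"
    by (simp add: ses_value_def pair_mechanism_def pair_continuation_def action_law_def
        bind_return_pmf map_pmf_def)
  then show ?thesis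
    by (simp add: matching_game_def)
qed

text \<open>Stated for an arbitrary law \<open>P\<close>, so that it bounds the values of both kinds
  of mechanism.\<close>

lemma matching_payoff_le_1:
  "measure_pmf.expectation P (\<lambda>(s, a). principal_payoff matching_game s a) \<le> 1"
  by (rule measure_pmf.integral_le_const)
     (auto intro!: measure_pmf.integrable_const_bound[where B = 1] simp: matching_game_def)

text \<open>The payoff is the indicator of the diagonal, so expectation 1 puts the whole support
  there.\<close>

lemma matching_payoff_eq_1D:
  assumes "measure_pmf.expectation P (\<lambda>(s, a). principal_payoff matching_game s a) = 1"
    and "(s, a) \<in> set_pmf P"
  shows "a = s"
proof -
  have "measure_pmf.expectation P (\<lambda>(s, a). principal_payoff matching_game s a)
      = measure_pmf.expectation P (indicator {(s, a). a = s})"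
    by (intro Bochner_Integration.integral_cong) (auto simp: matching_game_def indicator_def)
  then have "measure_pmf.prob P {(s, a). a = s} = 1"
    using assms(1) by simp
  then show ?thesis
    using assms(2) by (auto simp: measure_pmf.prob_eq_1 AE_measure_pmf_iff)
qed

lemma es_value_matching_less_1:
  fixes M :: "(nat, nat, nat, 'g) es_mech"
  assumes "es_mechanism matching_game M"
  shows "es_value matching_game M < 1"
proof (rule ccontr)
  assume "\<not> es_value matching_game M < 1"
  then have val: "es_value matching_game M = 1"
    using matching_payoff_le_1 unfolding es_value_def by (intro antisym) (auto simp: not_less)
  \<comment> \<open>Type 0 serves as an arbitrary type of positive probability; \<open>s\<close> is
    the first state of the pair on which type \<open>r\<close> is not aligned.\<close>
  define r where "r = chosen_report M 0"
  define s where "s = 2 * (1 - r)"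
  have inc: "es_incentives matching_game (prior matching_game) M"
    using assms by (simp add: es_mechanism_def)
  then have r: "r < 2"
    by (auto simp: es_incentives_def r_def matching_game_def)
  then have s: "s < 4" "s div 2 \<noteq> r"
    by (auto simp: s_def less_2_cases_iff)
  have match: "chosen_action M r g = s'" if "s' < 4" "g \<in> set_pmf (signal_law M r s')" for s' g
    by (rule matching_payoff_eq_1D[OF val[unfolded es_value_def]])
       (use that in \<open>force simp: set_prior_matching_game set_type_dist_matching_game
          action_law_def r_def\<close>)
  obtain g where g: "g \<in> set_pmf (signal_law M r s)"
    using set_pmf_not_empty by fast
  have g': "g \<in> set_pmf (bind_pmf (prior matching_game) (signal_law M r))"
    using g s(1) by (auto simp: set_prior_matching_game)
  \<comment> \<open>The action depends on \<open>g\<close> alone and matches every state that can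
    send \<open>g\<close>, so only \<open>s\<close> can.\<close>
  have "set_pmf (posterior (prior matching_game) (signal_law M r) g) \<subseteq> {s}"
    using match g s(1) by (auto simp: set_posterior[OF g'] set_prior_matching_game)
  then have "posterior (prior matching_game) (signal_law M r) g = return_pmf s"
    by (simp add: set_pmf_subset_singleton)
  moreover have "s \<in> best_actions matching_game r (posterior (prior matching_game) (signal_law M r) g)"
    using inc g' r match[OF s(1) g]
    by (fastforce simp: es_incentives_def matching_game_def)
  ultimately have "\<forall>b<4. agent_payoff matching_game r s b \<le> agent_payoff matching_game r s s"
    by (auto simp: best_actions_def matching_game_def)
  \<comment> \<open>This reads 3 \<le> 2.\<close>
  then have "agent_payoff matching_game r s ((s + 2) mod 4) \<le> agent_payoff matching_game r s s"
    by simp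
  then show False
    using s r by (auto simp: matching_game_def s_def less_2_cases_iff)
qed

theorem theorem3:
  shows "\<exists>(I :: (nat, nat, nat) game) (S :: (nat, nat, nat, nat, nat) ses_mech).
    game I \<and> optimal_ses I S \<and>
    (\<forall>M :: (nat, nat, nat, nat) es_mech. es_mechanism I M \<longrightarrow> es_value I M < ses_value I S)"
proof (intro exI conjI allI impI)
  show "game matching_game"
    by (rule game_matching_game)
  show "optimal_ses matching_game pair_mechanism"
    using ses_mechanism_pair matching_payoff_le_1
    by (auto simp: optimal_ses_def ses_value_pair) (simp add: ses_value_def)
  show "es_value matching_game M < ses_value matching_game pair_mechanism"
    if "es_mechanism matching_game M" for M :: "(nat, nat, nat, nat) es_mech"
    using es_value_matching_less_1[OF that] by (simp add: ses_value_pair)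
qed

end
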